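(* Let $\mu$ be an orthogonality measure on $\mathbb{R}$ and, for some integer $n\ge 0$, let $p_n$ be an orthogonal polynomial of degree $n$ with respect to $\mu$. Put $h_n:=\int_{\mathbb{R}}p_n(\xi)^2\,d\mu(\xi)$ and let $k_n$ be the coefficient of $x^n$ in $p_n(x)$. Let $x\in\mathbb{R}$. Let $I\subseteq\mathbb{R}$ be a closed interval such that, for some $\varepsilon>0$, $x+\delta\xi\in I$ whenever $0\le\delta\le\varepsilon$ and $\xi\in\operatorname{supp}(\mu)$. Let $f$ be a continuous function on $I$ such that its derivatives of order $1,2,\ldots,n$ at $x$ exist. In addition, if $I$ is unbounded, assume that $f$ is of at most polynomial growth on $I$. Then $$f^{(n)}(x)=\frac{k_n\,n!}{h_n}\,\lim_{\delta\downarrow0}\frac1{\delta^n}\int_{\mathbb{R}} f(x+\delta\xi)\,p_n(\xi)\,d\mu(\xi),$$ where the integral converges absolutely (for $0<\delta\le\varepsilon$).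
   Context: An orthogonality measure is a positive Borel measure $\mu$ on $\mathbb{R}$ with $\int_{\mathbb{R}}|x|^k\,d\mu(x)<\infty$ for all integers $k\ge0$, whose support is either infinite or a finite set of $N+1$ points. Orthogonal polynomials with respect to $\mu$ are real polynomials $p_k$ of exact degree $k$ with $\int_{\mathbb{R}}p_j\,p_k\,d\mu=0$ for $j\ne k$; here $k$ ranges over all integers $\ge0$ if $\operatorname{supp}(\mu)$ is infinite, and over $0,1,\ldots,N$ if $\operatorname{supp}(\mu)$ has $N+1$ points (so in that case $n\le N$). They are unique up to nonzero constant factors. If $x$ is an endpoint of $I$, derivatives at $x$ are interpreted as the corresponding one-sided derivatives. A function $g$ on $I$ is of (at most) polynomial growth if there are $C>0$, $r\ge0$ with $|g(y)|\le C(1+|y|)^r$ for all $y\in I$. *)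

theory Defs
  imports "HOL-Analysis.Analysis" "HOL-Computational_Algebra.Polynomial"
begin

definition msupport :: "real measure \<Rightarrow> real set" where
  "msupport \<mu> = {\<xi>. \<forall>U. open U \<longrightarrow> \<xi> \<in> U \<longrightarrow> emeasure \<mu> U > 0}"

(* The last conjunct excludes only the zero measure. *)
definition orthogonality_measure :: "real measure \<Rightarrow> bool" where
  "orthogonality_measure \<mu> \<longleftrightarrow>
     sets \<mu> = sets borel \<and>
     (\<forall>k::nat. integrable \<mu> (\<lambda>x. \<bar>x\<bar> ^ k)) \<and>
     (infinite (msupport \<mu>) \<or> (\<exists>N::nat. finite (msupport \<mu>) \<and> card (msupport \<mu>) = N + 1))"

(* All of the naturals for infinite support, {0..N} for a support of N + 1 points. *)
definition orth_degrees :: "real measure \<Rightarrow> nat set" where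
  "orth_degrees \<mu> = {k. infinite (msupport \<mu>) \<or> k < card (msupport \<mu>)}"

(* The condition p k \<noteq> 0 matters only for k = 0, since degree 0 = 0 for the zero polynomial.
   The values p k with k outside orth_degrees \<mu> are irrelevant. *)
definition orthogonal_polynomials :: "real measure \<Rightarrow> (nat \<Rightarrow> real poly) \<Rightarrow> bool" where
  "orthogonal_polynomials \<mu> p \<longleftrightarrow>
     (\<forall>k\<in>orth_degrees \<mu>. p k \<noteq> 0 \<and> degree (p k) = k) \<and>
     (\<forall>j\<in>orth_degrees \<mu>. \<forall>k\<in>orth_degrees \<mu>. j \<noteq> k \<longrightarrow>
        (\<integral>\<xi>. poly (p j) \<xi> * poly (p k) \<xi> \<partial>\<mu>) = 0)"

(* The k-th derivative of f relative to I: two-sided at interior points of the interval I,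
   one-sided at its endpoints.  Like vector_derivative it is total; the value is meaningful
   at y only under has_derivs_within I f k y. *)
definition nth_deriv_within :: "real set \<Rightarrow> (real \<Rightarrow> real) \<Rightarrow> nat \<Rightarrow> real \<Rightarrow> real" where
  "nth_deriv_within I f k = ((\<lambda>g y. vector_derivative g (at y within I)) ^^ k) f"

(* The derivatives of f of order 1, ..., k exist at y: those of order below k exist on a
   neighbourhood of y in I (which includes y itself), and the derivative of order k - 1 is
   differentiable at the point y. *)
primrec has_derivs_within :: "real set \<Rightarrow> (real \<Rightarrow> real) \<Rightarrow> nat \<Rightarrow> real \<Rightarrow> bool" where
  "has_derivs_within I f 0 y \<longleftrightarrow> True"
| "has_derivs_within I f (Suc k) y \<longleftrightarrow>
     (\<forall>\<^sub>F z in nhds y. z \<in> I \<longrightarrow> has_derivs_within I f k z) \<and>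
     nth_deriv_within I f k differentiable (at y within I)"

definition polynomial_growth_on :: "real set \<Rightarrow> (real \<Rightarrow> real) \<Rightarrow> bool" where
  "polynomial_growth_on I g \<longleftrightarrow>
     (\<exists>C>0. \<exists>r\<ge>0. \<forall>y\<in>I. \<bar>g y\<bar> \<le> C * (1 + \<bar>y\<bar>) powr r)"

(* Convention: a function f on I is a total function of which only the values on I matter.  Then
   the integrand f (x + \<delta> * \<xi>) * poly (p n) \<xi> is meaningful only on the support of \<mu>; off the
   support, a \<mu>-null set, arbitrary values of f could even destroy measurability.  Integrals over
   the real line of such integrands are therefore written as integrals over msupport \<mu>. *)

end

theory Submission
  imports Defs
begin

text \<open>
  Subtract from \<open>f\<close> its Taylor polynomial of degree \<open>n\<close> at \<open>x\<close>. Orthogonality kills all terms of the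
  polynomial of degree below \<open>n\<close>, and the top term contributes exactly the claimed limit. By
  Peano's form of Taylor's theorem and polynomial growth the remainder \<open>R\<close> satisfies
  \<open>\<bar>R t\<bar> \<le> C \<bar>t\<bar>\<^sup>n (1 + \<bar>t\<bar>)\<^sup>m\<close>, so \<open>R (\<delta> \<xi>) / \<delta>\<^sup>n\<close> is dominated by a polynomially
  growing function of \<open>\<xi>\<close> and tends to 0 for every \<open>\<xi>\<close>; dominated convergence finishes the proof.
\<close>

section \<open>Support and moments\<close>

lemma closed_msupport: "closed (msupport \<mu>)"
proof -
  have "open (- msupport \<mu>)"
  proof (subst open_subopen, intro ballI)
    fix \<xi> assume "\<xi> \<in> - msupport \<mu>"
    then obtain U where "open U" "\<xi> \<in> U" "\<not> emeasure \<mu> U > 0"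
      by (auto simp: msupport_def)
    then show "\<exists>T. open T \<and> \<xi> \<in> T \<and> T \<subseteq> - msupport \<mu>"
      by (intro exI[of _ U]) (auto simp: msupport_def)
  qed
  then show ?thesis
    by (simp add: closed_def)
qed

text \<open>The complement is the union of all open null sets. By Lindelof, countably many of them
  already cover it, so it is null.\<close>

lemma null_sets_compl_msupport:
  assumes "sets \<mu> = sets borel"
  shows "- msupport \<mu> \<in> null_sets \<mu>"
proof -
  define F where "F = {U. open U \<and> emeasure \<mu> U = 0}"
  have "- msupport \<mu> = \<Union>F"
    by (auto simp: F_def msupport_def zero_less_iff_neq_zero)
  moreover obtain F' where F': "F' \<subseteq> F" "countable F'" "\<Union>F' = \<Union>F"
    using Lindelof[of F] by (auto simp: F_def)
  moreover have "\<Union>F' \<in> null_sets \<mu>"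
    using null_sets_UN'[OF F'(2), of "\<lambda>U. U" \<mu>] F'(1) assms
    by (simp add: F_def null_sets_def subset_iff)
  ultimately show ?thesis by simp
qed

lemma AE_in_msupport:
  assumes "sets \<mu> = sets borel"
  shows "AE \<xi> in \<mu>. \<xi> \<in> msupport \<mu>"
  using AE_not_in[OF null_sets_compl_msupport[OF assms]] by simp

lemma orthogonality_measure_sets: "orthogonality_measure \<mu> \<Longrightarrow> sets \<mu> = sets borel"
  by (simp add: orthogonality_measure_def)

lemma integrable_poly:
  assumes "orthogonality_measure \<mu>"
  shows "integrable \<mu> (poly q)"
proof -
  note [measurable_cong] = orthogonality_measure_sets[OF assms]
  have "integrable \<mu> (\<lambda>\<xi>. \<xi> ^ i)" for i
    using assms
    by (intro Bochner_Integration.integrable_bound[of \<mu> "\<lambda>\<xi>. \<bar>\<xi>\<bar> ^ i" "\<lambda>\<xi>. \<xi> ^ i"])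
      (auto simp: orthogonality_measure_def power_abs)
  then have "integrable \<mu> (\<lambda>\<xi>. \<Sum>i\<le>degree q. coeff q i * \<xi> ^ i)"
    by (intro Bochner_Integration.integrable_sum integrable_mult_right)
  then show ?thesis
    by (simp add: poly_altdef[abs_def])
qed

lemma integrable_poly_mult:
  assumes "orthogonality_measure \<mu>"
  shows "integrable \<mu> (\<lambda>\<xi>. poly q \<xi> * poly r \<xi>)"
  using integrable_poly[OF assms, of "q * r"] by (simp add: poly_mult[abs_def])

text \<open>Supplies the integrable majorant for dominated convergence. Since
  \<open>1 + \<bar>\<xi>\<bar>\<close> is not a polynomial, it is replaced by the larger
  \<open>2 + 2 * \<xi>\<^sup>2\<close>, which reduces the claim to finite moments.\<close>

lemma integrable_weighted_poly:
  assumes "orthogonality_measure \<mu>"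
  shows "integrable \<mu> (\<lambda>\<xi>. \<bar>\<xi>\<bar> ^ n * (1 + \<bar>\<xi>\<bar>) ^ m * \<bar>poly q \<xi>\<bar>)"
proof (rule Bochner_Integration.integrable_bound)
  note [measurable_cong] = orthogonality_measure_sets[OF assms]
  show "integrable \<mu> (poly (monom 1 n * [:2, 0, 2:] ^ m * q))"
    by (rule integrable_poly[OF assms])
  have [measurable]: "poly q \<in> borel_measurable borel"
    by (intro borel_measurable_continuous_onI continuous_intros)
  show "(\<lambda>\<xi>. \<bar>\<xi>\<bar> ^ n * (1 + \<bar>\<xi>\<bar>) ^ m * \<bar>poly q \<xi>\<bar>) \<in> borel_measurable \<mu>"
    by measurable
  have le: "1 + \<bar>\<xi>\<bar> \<le> 2 + \<xi> * (\<xi> * 2)" for \<xi> :: real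
  proof -
    have "0 \<le> (\<bar>\<xi>\<bar> - 1)\<^sup>2" by simp
    also have "(\<bar>\<xi>\<bar> - 1)\<^sup>2 = \<xi> * \<xi> - 2 * \<bar>\<xi>\<bar> + 1"
      by (simp add: power2_diff) (simp add: power2_eq_square)
    finally show ?thesis
      using zero_le_square[of \<xi>] zero_le_square[of "\<bar>\<xi>\<bar>"] by linarith
  qed
  have "(1 + \<bar>\<xi>\<bar>) ^ m \<le> \<bar>(2 + \<xi> * (\<xi> * 2)) ^ m\<bar>" for \<xi> :: real
    using power_mono[OF le, of \<xi> m] by simp
  then show "AE \<xi> in \<mu>. norm (\<bar>\<xi>\<bar> ^ n * (1 + \<bar>\<xi>\<bar>) ^ m * \<bar>poly q \<xi>\<bar>)
      \<le> norm (poly (monom 1 n * [:2, 0, 2:] ^ m * q) \<xi>)"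
    by (intro AE_I2)
      (auto simp: poly_monom abs_mult power_abs intro!: mult_right_mono mult_left_mono)
qed

section \<open>Orthogonality\<close>

text \<open>Subtracting the multiple of \<open>p m\<close> that cancels the leading term of
  \<open>q\<close> lowers the degree and leaves the integral unchanged. Here \<open>m < n\<close> is
  admissible because \<open>orth_degrees \<mu>\<close> is downward closed.\<close>

lemma integral_orthogonal_lower_degree:
  assumes "orthogonality_measure \<mu>" "orthogonal_polynomials \<mu> p" "n \<in> orth_degrees \<mu>"
    and "degree q < n"
  shows "(\<integral>\<xi>. poly q \<xi> * poly (p n) \<xi> \<partial>\<mu>) = 0"
  using assms(4)
\<comment> \<open>The zero polynomial and the nonzero constants share degree 0. This measure
  separates them, so the step from a constant to \<open>r = 0\<close> is also a decrease.\<close>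
proof (induction "if q = 0 then 0 else Suc (degree q)" arbitrary: q rule: less_induct)
  case less
  show ?case
  proof (cases "q = 0")
    case False
    define m where "m = degree q"
    have m: "m \<in> orth_degrees \<mu>" "m \<noteq> n"
      using less.prems assms(3) by (auto simp: m_def orth_degrees_def)
    then have pm: "p m \<noteq> 0" "degree (p m) = m"
      and orth: "(\<integral>\<xi>. poly (p m) \<xi> * poly (p n) \<xi> \<partial>\<mu>) = 0"
      using assms(2,3) by (auto simp: orthogonal_polynomials_def)
    define c where "c = coeff q m / coeff (p m) m"
    define r where "r = q - smult c (p m)"
    have lc: "coeff (p m) m \<noteq> 0"
      using pm by (metis leading_coeff_0_iff)
    have dr: "degree r \<le> m"
      unfolding r_def using pm by (intro degree_diff_le) (auto simp: m_def)
    have r: "r = 0 \<or> degree r < m"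
    proof (rule disjCI)
      assume "\<not> degree r < m"
      moreover have "coeff r m = 0"
        using lc by (simp add: r_def c_def)
      ultimately show "r = 0"
        using dr by (metis leading_coeff_0_iff le_neq_implies_less)
    qed
    have "(\<integral>\<xi>. poly r \<xi> * poly (p n) \<xi> \<partial>\<mu>) = 0"
      using r less.prems False by (intro less.hyps) (auto simp: m_def)
    moreover have "integrable \<mu> (\<lambda>\<xi>. poly s \<xi> * poly (p n) \<xi>)" for s
      by (rule integrable_poly_mult[OF assms(1)])
    moreover have "poly q \<xi> * poly (p n) \<xi> =
        poly r \<xi> * poly (p n) \<xi> + c * (poly (p m) \<xi> * poly (p n) \<xi>)" for \<xi>
      by (simp add: r_def algebra_simps)
    ultimately show ?thesis
      using orth by simp
  qed simp
qed

lemma lead_coeff_orthogonal_nonzero: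
  assumes "orthogonal_polynomials \<mu> p" "n \<in> orth_degrees \<mu>"
  shows "coeff (p n) n \<noteq> 0"
  using assms by (metis leading_coeff_0_iff orthogonal_polynomials_def)

text \<open>Write \<open>q\<close> as a multiple of \<open>p n\<close> plus a polynomial of lower
  degree; only the multiple contributes to the integral.\<close>

lemma integral_orthogonal_degree_le:
  assumes "orthogonality_measure \<mu>" "orthogonal_polynomials \<mu> p" "n \<in> orth_degrees \<mu>"
    and "degree q \<le> n"
  shows "(\<integral>\<xi>. poly q \<xi> * poly (p n) \<xi> \<partial>\<mu>) =
    coeff q n * (\<integral>\<xi>. (poly (p n) \<xi>)\<^sup>2 \<partial>\<mu>) / coeff (p n) n"
proof -
  define c where "c = coeff q n / coeff (p n) n"
  define r where "r = q - smult c (p n)"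
  have "degree (p n) = n"
    using assms(2,3) by (simp add: orthogonal_polynomials_def)
  then have dr: "degree r \<le> n"
    unfolding r_def using assms(4) by (intro degree_diff_le) auto
  have "coeff r n = 0"
    using lead_coeff_orthogonal_nonzero[OF assms(2,3)] by (simp add: r_def c_def)
  with dr have "r = 0 \<or> degree r < n"
    by (metis leading_coeff_0_iff le_neq_implies_less)
  then have "(\<integral>\<xi>. poly r \<xi> * poly (p n) \<xi> \<partial>\<mu>) = 0"
    using integral_orthogonal_lower_degree[OF assms(1-3)] by auto
  moreover have "integrable \<mu> (\<lambda>\<xi>. poly s \<xi> * poly (p n) \<xi>)" for s
    by (rule integrable_poly_mult[OF assms(1)])
  moreover have "poly q \<xi> * poly (p n) \<xi> =
      poly r \<xi> * poly (p n) \<xi> + c * (poly (p n) \<xi> * poly (p n) \<xi>)" for \<xi>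
    by (simp add: r_def algebra_simps)
  ultimately show ?thesis
    by (simp add: c_def power2_eq_square)
qed

text \<open>If the integral vanished, the open set where \<open>q\<close> is nonzero would be null,
  so the support would lie among the roots of \<open>q\<close>. There are at most
  \<open>degree q\<close> roots, whereas an admissible degree is smaller than the number of support
  points.\<close>

lemma integral_poly_square_nonzero:
  assumes "orthogonality_measure \<mu>" "q \<noteq> 0" "degree q \<in> orth_degrees \<mu>"
  shows "(\<integral>\<xi>. (poly q \<xi>)\<^sup>2 \<partial>\<mu>) \<noteq> 0"
proof
  assume "(\<integral>\<xi>. (poly q \<xi>)\<^sup>2 \<partial>\<mu>) = 0"
  moreover have "integrable \<mu> (\<lambda>\<xi>. (poly q \<xi>)\<^sup>2)"
    using integrable_poly_mult[OF assms(1), of q q] by (simp add: power2_eq_square)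
  ultimately have ae: "AE \<xi> in \<mu>. poly q \<xi> = 0"
    by (subst (asm) integral_nonneg_eq_0_iff_AE) auto
  have op: "open {\<xi>. poly q \<xi> \<noteq> 0}"
    by (intro open_Collect_neq continuous_intros)
  have "emeasure \<mu> {\<xi>. poly q \<xi> \<noteq> 0} = 0"
    using ae op assms(1) sets_eq_imp_space_eq[of \<mu> borel]
    by (subst (asm) AE_iff_measurable[of "{\<xi>. poly q \<xi> \<noteq> 0}"])
      (auto simp: orthogonality_measure_def)
  with op have sub: "msupport \<mu> \<subseteq> {\<xi>. poly q \<xi> = 0}"
    by (auto simp: msupport_def)
  have "card {\<xi>. poly q \<xi> = 0} \<le> degree q"
    by (rule card_poly_roots_bound[OF assms(2)])
  moreover have "finite {\<xi>. poly q \<xi> = 0}"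
    by (rule poly_roots_finite[OF assms(2)])
  ultimately show False
    using sub assms(3) card_mono[of "{\<xi>. poly q \<xi> = 0}" "msupport \<mu>"]
    by (auto simp: orth_degrees_def dest: finite_subset)
qed

section \<open>Peano's form of Taylor's theorem\<close>

text \<open>The variable is the displacement from \<open>x\<close>, so \<open>f y\<close> is
  compared with the value at \<open>y - x\<close>, and a displacement
  \<open>\<delta> * \<xi>\<close> becomes a dilation of the argument.\<close>

definition taylor_poly :: "real set \<Rightarrow> (real \<Rightarrow> real) \<Rightarrow> nat \<Rightarrow> real \<Rightarrow> real poly" where
  "taylor_poly I f n x = (\<Sum>j\<le>n. monom (nth_deriv_within I f j x / fact j) j)"

lemma poly_taylor_poly:
  "poly (taylor_poly I f n x) t = (\<Sum>j\<le>n. nth_deriv_within I f j x / fact j * t ^ j)"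
  by (simp add: taylor_poly_def poly_sum poly_monom)

lemma degree_taylor_poly: "degree (taylor_poly I f n x) \<le> n"
  unfolding taylor_poly_def by (rule degree_sum_le) (auto intro: order_trans[OF degree_monom_le])

lemma coeff_taylor_poly:
  "coeff (taylor_poly I f n x) j = (if j \<le> n then nth_deriv_within I f j x / fact j else 0)"
  by (auto simp: taylor_poly_def coeff_sum)

text \<open>Iteration adds derivatives on the outside. Induction on the order in Taylor's theorem
  instead needs the innermost one split off.\<close>

lemma nth_deriv_within_Suc:
  "nth_deriv_within I f (Suc k) = nth_deriv_within I (\<lambda>y. vector_derivative f (at y within I)) k"
  by (simp only: nth_deriv_within_def funpow_Suc_right o_apply)

lemma pderiv_taylor_poly:
  "pderiv (taylor_poly I f (Suc n) x) =
    taylor_poly I (\<lambda>y. vector_derivative f (at y within I)) n x"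
  by (intro poly_eqI) (simp add: coeff_pderiv coeff_taylor_poly nth_deriv_within_Suc field_simps
      del: of_nat_Suc)

text \<open>Lets the induction for Taylor's theorem pass from \<open>f\<close> to its derivative,
  although the predicate recurses on the outermost derivative.\<close>

lemma has_derivs_within_Suc_derivative:
  "has_derivs_within I f (Suc k) y \<Longrightarrow>
    has_derivs_within I (\<lambda>y. vector_derivative f (at y within I)) k y"
proof (induction k arbitrary: y)
  case (Suc k)
  have "\<forall>\<^sub>F z in nhds y. z \<in> I \<longrightarrow> has_derivs_within I f (Suc k) z"
    using Suc.prems unfolding has_derivs_within.simps(2)[of I f "Suc k"] by blast
  then have "\<forall>\<^sub>F z in nhds y. z \<in> I \<longrightarrow>
      has_derivs_within I (\<lambda>y. vector_derivative f (at y within I)) k z"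
    by (rule eventually_mono) (use Suc.IH in blast)
  moreover have "nth_deriv_within I f (Suc k) differentiable (at y within I)"
    using Suc.prems unfolding has_derivs_within.simps(2)[of I f "Suc k"] by blast
  ultimately show ?case
    by (simp add: nth_deriv_within_Suc)
qed simp

lemma has_derivs_within_differentiable:
  "has_derivs_within I f (Suc k) y \<Longrightarrow> y \<in> I \<Longrightarrow> f differentiable (at y within I)"
proof (induction k)
  case 0
  then show ?case by (simp add: nth_deriv_within_def)
next
  case (Suc k)
  then have "\<forall>\<^sub>F z in nhds y. z \<in> I \<longrightarrow> has_derivs_within I f (Suc k) z"
    unfolding has_derivs_within.simps(2)[of I f "Suc k"] by blast
  from eventually_nhds_x_imp_x[OF this] Suc show ?case by blast
qed

text \<open>Induction on the order, applied to the derivative of \<open>f\<close>: its remainder is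
  the derivative of the remainder of \<open>f\<close>, and the mean value inequality gains one power
  of \<open>\<bar>y - x\<bar>\<close>.\<close>

lemma taylor_peano_within:
  assumes "is_interval I" "x \<in> I" "continuous (at x within I) f" "has_derivs_within I f n x" "e > 0"
  shows "\<exists>d>0. \<forall>y\<in>I. \<bar>y - x\<bar> < d \<longrightarrow>
    \<bar>f y - poly (taylor_poly I f n x) (y - x)\<bar> \<le> e * \<bar>y - x\<bar> ^ n"
  using assms(3,4)
proof (induction n arbitrary: f)
  case 0
  then show ?case
    using \<open>e > 0\<close> unfolding continuous_within_eps_delta
    by (fastforce simp: poly_taylor_poly nth_deriv_within_def dist_real_def intro: less_imp_le)
next
  case (Suc n)
  define f' where "f' = (\<lambda>y. vector_derivative f (at y within I))"
  have hd': "has_derivs_within I f' n x"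
    unfolding f'_def by (rule has_derivs_within_Suc_derivative[OF Suc.prems(2)])
  have works: "(f has_vector_derivative f' y) (at y within I)"
    if "f differentiable (at y within I)" for y
    using that unfolding f'_def by (simp add: vector_derivative_works)
  show ?case
  proof (cases n)
    \<comment> \<open>At order 1 the derivative of \<open>f\<close> is only known at
      \<open>x\<close>, so no mean value argument is available; the claim is the definition of
      differentiability at \<open>x\<close>.\<close>
    case 0
    have "(f has_derivative (\<lambda>h. h * f' x)) (at x within I)"
      using works[OF has_derivs_within_differentiable[OF Suc.prems(2) \<open>x \<in> I\<close>]]
      by (simp add: has_vector_derivative_def)
    then show ?thesis
      using \<open>e > 0\<close> unfolding has_derivative_within_alt
      by (auto simp: poly_taylor_poly 0 nth_deriv_within_def f'_def algebra_simps)
  next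
    case (Suc m)
    \<comment> \<open>From order 2 on, \<open>f'\<close> is differentiable at \<open>x\<close>,
      which yields the continuity that the induction hypothesis demands.\<close>
    have "f' differentiable (at x within I)"
      using has_derivs_within_differentiable[of I f' m x] hd' Suc \<open>x \<in> I\<close> by simp
    then have "continuous (at x within I) f'"
      by (rule differentiable_imp_continuous_within)
    from Suc.IH[OF this hd'] obtain d where d: "d > 0"
      "\<And>y. y \<in> I \<Longrightarrow> \<bar>y - x\<bar> < d \<Longrightarrow>
        \<bar>f' y - poly (taylor_poly I f' n x) (y - x)\<bar> \<le> e * \<bar>y - x\<bar> ^ n"
      by blast
    have "\<forall>\<^sub>F z in nhds x. z \<in> I \<longrightarrow> has_derivs_within I f n z"
      using Suc.prems(2) by simp
    then obtain d' where d': "d' > 0" "\<And>z. z \<in> I \<Longrightarrow> \<bar>z - x\<bar> < d' \<Longrightarrow> has_derivs_within I f n z"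
      unfolding eventually_nhds_metric dist_real_def by blast
    define R where "R = (\<lambda>y. f y - poly (taylor_poly I f (Suc n) x) (y - x))"
    define R' where "R' = (\<lambda>y. f' y - poly (taylor_poly I f' n x) (y - x))"
    have R': "(R has_field_derivative R' z) (at z within I)" if "z \<in> I" "\<bar>z - x\<bar> < d'" for z
    proof -
      have "(f has_field_derivative f' z) (at z within I)"
        using works[OF has_derivs_within_differentiable[of I f m z]] d'(2)[OF that] that Suc
        by (simp add: has_real_derivative_iff_has_vector_derivative)
      then show ?thesis
        unfolding R_def R'_def f'_def pderiv_taylor_poly[symmetric]
        by (auto intro!: derivative_eq_intros)
    qed
    have "\<bar>R y\<bar> \<le> e * \<bar>y - x\<bar> ^ Suc n" if y: "y \<in> I" "\<bar>y - x\<bar> < min d d'" for y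
    proof -
      \<comment> \<open>A convex set containing \<open>x\<close> and \<open>y\<close> on which
        \<open>\<bar>z - x\<bar> \<le> \<bar>y - x\<bar>\<close>, so the bound on \<open>R'\<close>
        is uniform over it.\<close>
      define S where "S = I \<inter> cball x \<bar>y - x\<bar>"
      have S: "z \<in> I \<and> \<bar>z - x\<bar> \<le> \<bar>y - x\<bar>" if "z \<in> S" for z
        using that by (auto simp: S_def dist_real_def abs_minus_commute)
      have "norm (R y - R x) \<le> e * \<bar>y - x\<bar> ^ n * norm (y - x)"
      proof (rule field_differentiable_bound[of S R R'])
        show "convex S"
          unfolding S_def using assms(1) by (intro convex_Int is_interval_convex) auto
        fix z assume "z \<in> S"
        note z = S[OF this]
        show "(R has_field_derivative R' z) (at z within S)"
          using R'[of z] z y by (auto simp: S_def intro: DERIV_subset)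
        have "\<bar>R' z\<bar> \<le> e * \<bar>z - x\<bar> ^ n"
          unfolding R'_def using d(2)[of z] z y by auto
        also have "\<dots> \<le> e * \<bar>y - x\<bar> ^ n"
          using z \<open>e > 0\<close> by (intro mult_left_mono power_mono) auto
        finally show "norm (R' z) \<le> e * \<bar>y - x\<bar> ^ n" by simp
      qed (use y \<open>x \<in> I\<close> in \<open>auto simp: S_def dist_real_def abs_minus_commute\<close>)
      moreover have "R x = 0"
        unfolding R_def poly_taylor_poly by (subst sum.atMost_Suc_shift) (simp add: nth_deriv_within_def)
      ultimately show ?thesis by (simp add: mult_ac)
    qed
    then show ?thesis
      using d(1) d'(1) unfolding R_def by (intro exI[of _ "min d d'"]) auto
  qed
qed

section \<open>The remainder\<close>

text \<open>Puts both cases in one form: compactness bounds \<open>f\<close> on a bounded interval,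
  and otherwise the real exponent may be rounded up to a natural one because the base is at least
  1.\<close>

lemma growth_bound:
  assumes "closed I" "continuous_on I f" "\<not> bounded I \<Longrightarrow> polynomial_growth_on I f"
  shows "\<exists>C m. C \<ge> 0 \<and> (\<forall>y\<in>I. \<bar>f y\<bar> \<le> C * (1 + \<bar>y\<bar>) ^ m)"
proof (cases "bounded I")
  case True
  then have "bounded (f ` I)"
    using assms by (intro compact_imp_bounded compact_continuous_image) (auto simp: compact_eq_bounded_closed)
  then obtain B where "\<And>y. y \<in> I \<Longrightarrow> \<bar>f y\<bar> \<le> B" "B > 0"
    by (auto simp: bounded_pos)
  then show ?thesis
    by (intro exI[of _ B] exI[of _ 0]) auto
next
  case False
  then obtain C r where C: "C > 0" "r \<ge> 0" "\<And>y. y \<in> I \<Longrightarrow> \<bar>f y\<bar> \<le> C * (1 + \<bar>y\<bar>) powr r"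
    using assms(3) by (auto simp: polynomial_growth_on_def)
  have "C * (1 + \<bar>y\<bar>) powr r \<le> C * (1 + \<bar>y\<bar>) ^ nat \<lceil>r\<rceil>" for y
  proof -
    have "(1 + \<bar>y\<bar>) powr r \<le> (1 + \<bar>y\<bar>) powr real (nat \<lceil>r\<rceil>)"
      by (intro powr_mono) (auto simp: real_nat_ceiling_ge)
    also have "\<dots> = (1 + \<bar>y\<bar>) ^ nat \<lceil>r\<rceil>"
      by (rule powr_realpow) simp
    finally show ?thesis using C(1) by simp
  qed
  with C show ?thesis
    by (meson order_trans less_imp_le)
qed

lemma abs_poly_le:
  fixes q :: "real poly"
  shows "\<bar>poly q t\<bar> \<le> (\<Sum>j\<le>degree q. \<bar>coeff q j\<bar>) * (1 + \<bar>t\<bar>) ^ degree q"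
proof -
  have "\<bar>coeff q j * t ^ j\<bar> \<le> \<bar>coeff q j\<bar> * (1 + \<bar>t\<bar>) ^ degree q" if "j \<le> degree q" for j
  proof -
    have "\<bar>t\<bar> ^ j \<le> (1 + \<bar>t\<bar>) ^ j"
      by (intro power_mono) auto
    also have "\<dots> \<le> (1 + \<bar>t\<bar>) ^ degree q"
      using that by (intro power_increasing) auto
    finally show ?thesis
      by (simp add: abs_mult power_abs mult_left_mono)
  qed
  then show ?thesis
    unfolding poly_altdef sum_distrib_right
    by (intro order_trans[OF sum_abs] sum_mono) auto
qed

text \<open>Near \<open>x\<close> this is Peano's bound. Away from \<open>x\<close> polynomial
  growth suffices, since the factor \<open>\<bar>t\<bar> ^ n\<close> is there bounded below by a
  positive constant. Keeping that factor globally is what later allows division by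
  \<open>\<delta> ^ n\<close>.\<close>

lemma remainder_bound:
  assumes "closed I" "is_interval I" "x \<in> I" "continuous_on I f" "has_derivs_within I f n x"
    and "\<not> bounded I \<Longrightarrow> polynomial_growth_on I f"
  shows "\<exists>C m. C \<ge> 0 \<and> (\<forall>t. x + t \<in> I \<longrightarrow>
    \<bar>f (x + t) - poly (taylor_poly I f n x) t\<bar> \<le> C * \<bar>t\<bar> ^ n * (1 + \<bar>t\<bar>) ^ m)"
proof -
  define q where "q = taylor_poly I f n x"
  have "continuous (at x within I) f"
    using assms(3,4) by (simp add: continuous_on_eq_continuous_within)
  from taylor_peano_within[OF assms(2,3) this assms(5), of 1] obtain d where d: "d > 0"
    "\<And>y. y \<in> I \<Longrightarrow> \<bar>y - x\<bar> < d \<Longrightarrow> \<bar>f y - poly q (y - x)\<bar> \<le> \<bar>y - x\<bar> ^ n"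
    unfolding q_def by auto
  obtain A a where A: "A \<ge> 0" "\<And>y. y \<in> I \<Longrightarrow> \<bar>f y\<bar> \<le> A * (1 + \<bar>y\<bar>) ^ a"
    using growth_bound[OF assms(1,4,6)] by blast
  define B where "B = (\<Sum>j\<le>degree q. \<bar>coeff q j\<bar>)"
  define m where "m = a + degree q"
  define E where "E = A * (1 + \<bar>x\<bar>) ^ a + B"
  have B: "B \<ge> 0" unfolding B_def by (simp add: sum_nonneg)
  have E: "E \<ge> 0" using A(1) B by (simp add: E_def)
  have "\<bar>f (x + t) - poly q t\<bar> \<le> (1 + E / d ^ n) * \<bar>t\<bar> ^ n * (1 + \<bar>t\<bar>) ^ m" if t: "x + t \<in> I" for t
  proof (cases "\<bar>t\<bar> < d")
    case True
    have "\<bar>f (x + t) - poly q t\<bar> \<le> 1 * \<bar>t\<bar> ^ n * 1"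
      using d(2)[OF t] True by simp
    also have "\<dots> \<le> (1 + E / d ^ n) * \<bar>t\<bar> ^ n * (1 + \<bar>t\<bar>) ^ m"
      using E d(1) by (intro mult_mono) auto
    finally show ?thesis .
  next
    case False
    have "\<bar>f (x + t)\<bar> \<le> A * (1 + \<bar>x + t\<bar>) ^ a"
      by (rule A(2)[OF t])
    also have "\<dots> \<le> A * ((1 + \<bar>x\<bar>) * (1 + \<bar>t\<bar>)) ^ a"
    proof (intro mult_left_mono power_mono A(1))
      have "0 \<le> \<bar>x\<bar> * \<bar>t\<bar>" by simp
      then show "1 + \<bar>x + t\<bar> \<le> (1 + \<bar>x\<bar>) * (1 + \<bar>t\<bar>)"
        using abs_triangle_ineq[of x t] unfolding ring_distribs by linarith
    qed simp
    also have "\<dots> \<le> A * (1 + \<bar>x\<bar>) ^ a * (1 + \<bar>t\<bar>) ^ m"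
      using A(1) by (auto simp: power_mult_distrib m_def mult.assoc intro!: mult_left_mono power_increasing)
    finally have 1: "\<bar>f (x + t)\<bar> \<le> A * (1 + \<bar>x\<bar>) ^ a * (1 + \<bar>t\<bar>) ^ m" .
    have "\<bar>poly q t\<bar> \<le> B * (1 + \<bar>t\<bar>) ^ degree q"
      unfolding B_def by (rule abs_poly_le)
    also have "\<dots> \<le> B * (1 + \<bar>t\<bar>) ^ m"
      using B by (intro mult_left_mono power_increasing) (auto simp: m_def)
    finally have "\<bar>f (x + t) - poly q t\<bar> \<le> E * (1 + \<bar>t\<bar>) ^ m"
      using 1 abs_triangle_ineq4[of "f (x + t)" "poly q t"] unfolding E_def ring_distribs by linarith
    also have "\<dots> \<le> (1 + E / d ^ n) * \<bar>t\<bar> ^ n * (1 + \<bar>t\<bar>) ^ m"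
    proof (rule mult_right_mono)
      \<comment> \<open>The missing power is bought with
        \<open>d \<le> \<bar>t\<bar>\<close>.\<close>
      have "E = E / d ^ n * d ^ n"
        using d(1) by simp
      also have "\<dots> \<le> (1 + E / d ^ n) * \<bar>t\<bar> ^ n"
        using False d(1) E by (intro mult_mono power_mono) auto
      finally show "E \<le> (1 + E / d ^ n) * \<bar>t\<bar> ^ n" .
    qed simp
    finally show ?thesis .
  qed
  moreover have "0 \<le> 1 + E / d ^ n"
    using E d(1) by simp
  ultimately show ?thesis
    unfolding q_def by blast
qed

text \<open>Pointwise convergence for dominated convergence: for fixed \<open>\<xi>\<close> the
  remainder is \<open>o(\<delta> ^ n)\<close> as the displacement \<open>\<delta> * \<xi>\<close>
  shrinks.\<close>

lemma remainder_tendsto: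
  assumes "is_interval I" "x \<in> I" "continuous_on I f" "has_derivs_within I f n x"
    and "\<epsilon> > 0" "\<And>\<delta>. 0 \<le> \<delta> \<Longrightarrow> \<delta> \<le> \<epsilon> \<Longrightarrow> x + \<delta> * \<xi> \<in> I"
  shows "((\<lambda>\<delta>. (f (x + \<delta> * \<xi>) - poly (taylor_poly I f n x) (\<delta> * \<xi>)) / \<delta> ^ n) \<longlongrightarrow> 0) (at_right 0)"
    (is "(?g \<longlongrightarrow> 0) _")
proof (rule tendstoI)
  fix e :: real assume "e > 0"
  \<comment> \<open>Using \<open>1 + \<bar>\<xi>\<bar>\<close> in place of
    \<open>\<bar>\<xi>\<bar>\<close> avoids a zero denominator at \<open>\<xi> = 0\<close>; the
    factor 2 makes the final inequality strict.\<close>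
  define e' where "e' = e / (2 * (1 + \<bar>\<xi>\<bar>) ^ n)"
  have e': "e' > 0" using \<open>e > 0\<close> by (simp add: e'_def)
  have "continuous (at x within I) f"
    using assms(2,3) by (simp add: continuous_on_eq_continuous_within)
  from taylor_peano_within[OF assms(1,2) this assms(4) e'] obtain d where d: "d > 0"
    "\<And>y. y \<in> I \<Longrightarrow> \<bar>y - x\<bar> < d \<Longrightarrow>
      \<bar>f y - poly (taylor_poly I f n x) (y - x)\<bar> \<le> e' * \<bar>y - x\<bar> ^ n"
    by auto
  define b where "b = min \<epsilon> (d / (1 + \<bar>\<xi>\<bar>))"
  have "b > 0" using assms(5) d(1) by (simp add: b_def)
  then have "\<forall>\<^sub>F \<delta> in at_right 0. 0 < \<delta> \<and> \<delta> < b"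
    unfolding eventually_at_right_field by auto
  then show "\<forall>\<^sub>F \<delta> in at_right 0. dist (?g \<delta>) 0 < e"
  proof eventually_elim
    case (elim \<delta>)
    have "\<delta> * \<bar>\<xi>\<bar> \<le> \<delta> * (1 + \<bar>\<xi>\<bar>)"
      using elim by simp
    also have "\<dots> < d"
      using elim by (simp add: b_def pos_less_divide_eq)
    finally have "\<bar>f (x + \<delta> * \<xi>) - poly (taylor_poly I f n x) (\<delta> * \<xi>)\<bar> \<le> e' * \<bar>\<delta> * \<xi>\<bar> ^ n"
      using d(2)[of "x + \<delta> * \<xi>"] assms(6)[of \<delta>] elim by (simp add: b_def abs_mult)
    then have "\<bar>?g \<delta>\<bar> \<le> e' * \<bar>\<xi>\<bar> ^ n"
      using elim by (simp add: abs_mult power_mult_distrib pos_divide_le_eq mult_ac)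
    also have "\<dots> \<le> e' * (1 + \<bar>\<xi>\<bar>) ^ n"
      using e' by (intro mult_left_mono power_mono) auto
    also have "\<dots> = e / 2"
      by (simp add: e'_def)
    also have "\<dots> < e"
      using \<open>e > 0\<close> by simp
    finally show ?case by simp
  qed
qed

section \<open>The limit formula by orthogonality and dominated convergence\<close>

theorem theorem3p1:
  fixes \<mu> :: "real measure" and p :: "nat \<Rightarrow> real poly" and n :: nat
    and x \<epsilon> h k :: real and I :: "real set" and f :: "real \<Rightarrow> real"
  assumes "orthogonality_measure \<mu>"
    and "orthogonal_polynomials \<mu> p"
    and "n \<in> orth_degrees \<mu>"
    and "h = (\<integral>\<xi>. (poly (p n) \<xi>)\<^sup>2 \<partial>\<mu>)"
    and "k = coeff (p n) n"
    and "closed I" and "is_interval I"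
    and "\<epsilon> > 0"
    and "\<And>\<delta> \<xi>. 0 \<le> \<delta> \<Longrightarrow> \<delta> \<le> \<epsilon> \<Longrightarrow> \<xi> \<in> msupport \<mu> \<Longrightarrow> x + \<delta> * \<xi> \<in> I"
    and "continuous_on I f"
    and "has_derivs_within I f n x"
    and "\<not> bounded I \<Longrightarrow> polynomial_growth_on I f"
  shows "(\<forall>\<delta>. 0 < \<delta> \<and> \<delta> \<le> \<epsilon> \<longrightarrow>
            set_integrable \<mu> (msupport \<mu>) (\<lambda>\<xi>. f (x + \<delta> * \<xi>) * poly (p n) \<xi>)) \<and>
         (\<exists>L. ((\<lambda>\<delta>. 1 / \<delta> ^ n *
                  (LINT \<xi>:msupport \<mu>|\<mu>. f (x + \<delta> * \<xi>) * poly (p n) \<xi>)) \<longlongrightarrow> L) (at_right 0) \<and>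
              nth_deriv_within I f n x = k * fact n / h * L)"
proof -
  let ?S = "msupport \<mu>"
  define q where "q = taylor_poly I f n x"
  \<comment> \<open>The claimed formula solved for the limit.\<close>
  define L where "L = nth_deriv_within I f n x / fact n * h / k"
  \<comment> \<open>The scaled remainder integrand, cut off to the support because \<open>f\<close>
    is controlled only on \<open>I\<close>.\<close>
  define g where "g = (\<lambda>\<delta> \<xi>. indicator ?S \<xi> *\<^sub>R
    ((f (x + \<delta> * \<xi>) - poly q (\<delta> * \<xi>)) / \<delta> ^ n * poly (p n) \<xi>))"
  note sets = orthogonality_measure_sets[OF assms(1)]
  note [measurable_cong] = sets
  have S_meas [measurable]: "?S \<in> sets borel"
    by (simp add: closed_msupport)
  \<comment> \<open>With \<open>\<delta> = 0\<close>, a single support point already places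
    \<open>x\<close> in \<open>I\<close>.\<close>
  have "?S \<noteq> {}"
    using assms(1) by (auto simp: orthogonality_measure_def)
  then have "x \<in> I"
    using assms(9)[of 0] assms(8) by auto
  obtain C m where C: "C \<ge> 0"
    "\<And>t. x + t \<in> I \<Longrightarrow> \<bar>f (x + t) - poly q t\<bar> \<le> C * \<bar>t\<bar> ^ n * (1 + \<bar>t\<bar>) ^ m"
    using remainder_bound[OF assms(6,7) \<open>x \<in> I\<close> assms(10,11,12)] unfolding q_def by blast
  \<comment> \<open>A majorant of \<open>g \<delta>\<close> independent of \<open>\<delta>\<close>:
    the power \<open>\<delta> ^ n\<close> cancels, and \<open>1 + \<bar>\<delta> * \<xi>\<bar> \<le>
    (1 + \<epsilon>) * (1 + \<bar>\<xi>\<bar>)\<close>.\<close>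
  define w where "w = (\<lambda>\<xi>. C * (1 + \<epsilon>) ^ m * (\<bar>\<xi>\<bar> ^ n * (1 + \<bar>\<xi>\<bar>) ^ m * \<bar>poly (p n) \<xi>\<bar>))"
  have w: "integrable \<mu> w"
    unfolding w_def by (intro integrable_mult_right integrable_weighted_poly assms(1))
  \<comment> \<open>On the closed support, \<open>\<xi>\<close> is mapped into \<open>I\<close>,
    where \<open>f\<close> is continuous; extension by zero keeps the function Borel.\<close>
  have g_meas [measurable]: "g \<delta> \<in> borel_measurable \<mu>" if "0 < \<delta>" "\<delta> \<le> \<epsilon>" for \<delta>
  proof -
    have "continuous_on ?S (\<lambda>\<xi>. f (x + \<delta> * \<xi>))"
      using assms(9)[of \<delta>] that
      by (intro continuous_on_compose2[OF assms(10)] continuous_intros) auto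
    then have "g \<delta> \<in> borel_measurable borel"
      unfolding g_def using that
      by (intro borel_measurable_continuous_on_indicator continuous_intros) (auto simp: S_meas)
    then show ?thesis
      using sets by (simp cong: measurable_cong_sets)
  qed
  have g_le: "norm (g \<delta> \<xi>) \<le> w \<xi>" if "0 < \<delta>" "\<delta> \<le> \<epsilon>" for \<delta> \<xi>
  proof (cases "\<xi> \<in> ?S")
    case True
    have "\<bar>f (x + \<delta> * \<xi>) - poly q (\<delta> * \<xi>)\<bar> \<le> C * \<bar>\<delta> * \<xi>\<bar> ^ n * (1 + \<bar>\<delta> * \<xi>\<bar>) ^ m"
      using C(2)[of "\<delta> * \<xi>"] assms(9)[of \<delta> \<xi>] that True by simp
    also have "\<dots> \<le> C * \<bar>\<delta> * \<xi>\<bar> ^ n * ((1 + \<epsilon>) * (1 + \<bar>\<xi>\<bar>)) ^ m"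
    proof (intro mult_left_mono power_mono)
      have "\<delta> * \<bar>\<xi>\<bar> \<le> \<epsilon> * \<bar>\<xi>\<bar>"
        using that by (intro mult_right_mono) auto
      then show "1 + \<bar>\<delta> * \<xi>\<bar> \<le> (1 + \<epsilon>) * (1 + \<bar>\<xi>\<bar>)"
        using that by (simp add: abs_mult algebra_simps)
    qed (use C(1) in auto)
    also have "\<dots> = C * (1 + \<epsilon>) ^ m * (\<bar>\<xi>\<bar> ^ n * (1 + \<bar>\<xi>\<bar>) ^ m) * \<delta> ^ n"
      using that by (simp add: abs_mult power_mult_distrib mult_ac)
    finally have "\<bar>f (x + \<delta> * \<xi>) - poly q (\<delta> * \<xi>)\<bar> / \<delta> ^ n
        \<le> C * (1 + \<epsilon>) ^ m * (\<bar>\<xi>\<bar> ^ n * (1 + \<bar>\<xi>\<bar>) ^ m)"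
      using that by (simp add: pos_divide_le_eq)
    from mult_right_mono[OF this, of "\<bar>poly (p n) \<xi>\<bar>"] show ?thesis
      using True that by (simp add: g_def w_def abs_mult mult.assoc)
  next
    case False
    then show ?thesis
      using C(1) assms(8) by (simp add: g_def w_def)
  qed
  have g_int: "integrable \<mu> (g \<delta>)" if "0 < \<delta>" "\<delta> \<le> \<epsilon>" for \<delta>
    using that g_le order_trans[OF g_le abs_ge_self]
    by (intro Bochner_Integration.integrable_bound[OF w] g_meas) auto
  have dilate: "poly q (\<delta> * \<xi>) = poly (q \<circ>\<^sub>p [:0, \<delta>:]) \<xi>" for \<delta> \<xi>
    by (simp add: poly_pcompose mult.commute)
  have T_int: "integrable \<mu> (\<lambda>\<xi>. poly q (\<delta> * \<xi>) * poly (p n) \<xi>)" for \<delta>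
    unfolding dilate by (rule integrable_poly_mult[OF assms(1)])
  \<comment> \<open>The dilated Taylor polynomial still has degree at most \<open>n\<close>, so only
    its top coefficient counts, and dilation multiplies that by \<open>\<delta> ^ n\<close>.\<close>
  have T_val: "(\<integral>\<xi>. poly q (\<delta> * \<xi>) * poly (p n) \<xi> \<partial>\<mu>) = \<delta> ^ n * L" for \<delta>
  proof -
    have "degree (q \<circ>\<^sub>p [:0, \<delta>:]) \<le> n"
      using degree_taylor_poly[of I f n x] by (simp add: q_def degree_pcompose)
    from integral_orthogonal_degree_le[OF assms(1-3) this] show ?thesis
      by (simp add: dilate[unfolded q_def] coeff_pcompose_linear q_def coeff_taylor_poly L_def assms(4,5))
  qed
  have T_ind: "integrable \<mu> (\<lambda>\<xi>. indicator ?S \<xi> *\<^sub>R (poly q (\<delta> * \<xi>) * poly (p n) \<xi>))"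
    and T_ind_val: "(\<integral>\<xi>. indicator ?S \<xi> *\<^sub>R (poly q (\<delta> * \<xi>) * poly (p n) \<xi>) \<partial>\<mu>) = \<delta> ^ n * L" for \<delta>
  proof -
    show "integrable \<mu> (\<lambda>\<xi>. indicator ?S \<xi> *\<^sub>R (poly q (\<delta> * \<xi>) * poly (p n) \<xi>))"
      using integrable_mult_indicator[OF _ T_int[of \<delta>], of ?S] sets S_meas by simp
    \<comment> \<open>The support carries the whole measure, so the cutoff does not change the
      integral.\<close>
    have "(\<integral>\<xi>. indicator ?S \<xi> *\<^sub>R (poly q (\<delta> * \<xi>) * poly (p n) \<xi>) \<partial>\<mu>) =
        (\<integral>\<xi>. poly q (\<delta> * \<xi>) * poly (p n) \<xi> \<partial>\<mu>)"
      using AE_in_msupport[OF sets] T_int[of \<delta>]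
        \<open>integrable \<mu> (\<lambda>\<xi>. indicator ?S \<xi> *\<^sub>R (poly q (\<delta> * \<xi>) * poly (p n) \<xi>))\<close>
      by (intro integral_cong_AE) auto
    then show "(\<integral>\<xi>. indicator ?S \<xi> *\<^sub>R (poly q (\<delta> * \<xi>) * poly (p n) \<xi>) \<partial>\<mu>) = \<delta> ^ n * L"
      by (simp add: T_val)
  qed
  have split: "indicator ?S \<xi> *\<^sub>R (f (x + \<delta> * \<xi>) * poly (p n) \<xi>) =
      indicator ?S \<xi> *\<^sub>R (poly q (\<delta> * \<xi>) * poly (p n) \<xi>) + \<delta> ^ n * g \<delta> \<xi>" if "0 < \<delta>" for \<delta> \<xi>
    using that by (simp add: g_def field_simps)
  have integrable: "set_integrable \<mu> ?S (\<lambda>\<xi>. f (x + \<delta> * \<xi>) * poly (p n) \<xi>)"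
    and quotient: "1 / \<delta> ^ n * (LINT \<xi>:?S|\<mu>. f (x + \<delta> * \<xi>) * poly (p n) \<xi>) = L + (\<integral>\<xi>. g \<delta> \<xi> \<partial>\<mu>)"
    if "0 < \<delta>" "\<delta> \<le> \<epsilon>" for \<delta>
    using T_ind[of \<delta>] T_ind_val[of \<delta>] g_int[OF that] that(1)
    unfolding set_integrable_def set_lebesgue_integral_def split[OF that(1)]
    by (auto simp: field_simps)
  \<comment> \<open>Dominated convergence is applied along sequences; this form of the filter keeps
    every term of them in the range where \<open>w\<close> dominates.\<close>
  have at_eq: "at_right 0 = at 0 within {0..\<epsilon>}"
    using at_within_Icc_at_right[of 0 \<epsilon>] assms(8) by simp
  have "((\<lambda>\<delta>. \<integral>\<xi>. g \<delta> \<xi> \<partial>\<mu>) \<longlongrightarrow> 0) (at_right 0)"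
    unfolding at_eq tendsto_at_iff_sequentially o_def
  proof (intro allI impI)
    fix X :: "nat \<Rightarrow> real"
    assume X: "\<forall>i. X i \<in> {0..\<epsilon>} - {0}" "X \<longlonglongrightarrow> 0"
    then have X': "0 < X i" "X i \<le> \<epsilon>" for i
      by (auto simp: order_le_less)
    have "(\<lambda>i. g (X i) \<xi>) \<longlonglongrightarrow> 0" for \<xi>
    proof (cases "\<xi> \<in> ?S")
      case True
      have "filterlim X (at_right 0) sequentially"
        using X' X(2) by (intro tendsto_imp_filterlim_at_right) auto
      from filterlim_compose[OF remainder_tendsto[OF assms(7) \<open>x \<in> I\<close> assms(10,11,8)] this]
      have "(\<lambda>i. (f (x + X i * \<xi>) - poly q (X i * \<xi>)) / X i ^ n) \<longlonglongrightarrow> 0"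
        unfolding q_def using assms(9) True by blast
      from tendsto_mult_left_zero[OF this, of "poly (p n) \<xi>"] show ?thesis
        using True by (simp add: g_def)
    qed (simp add: g_def)
    then have "(\<lambda>i. \<integral>\<xi>. g (X i) \<xi> \<partial>\<mu>) \<longlonglongrightarrow> (\<integral>\<xi>. 0 \<partial>\<mu>)"
      using w g_le X' by (intro integral_dominated_convergence[where w = w]) auto
    then show "(\<lambda>i. \<integral>\<xi>. g (X i) \<xi> \<partial>\<mu>) \<longlonglongrightarrow> 0"
      by simp
  qed
  from tendsto_add[OF tendsto_const this, of L]
  have "((\<lambda>\<delta>. L + (\<integral>\<xi>. g \<delta> \<xi> \<partial>\<mu>)) \<longlongrightarrow> L) (at_right 0)"
    by simp
  moreover have "\<forall>\<^sub>F \<delta> in at_right 0. L + (\<integral>\<xi>. g \<delta> \<xi> \<partial>\<mu>) =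
      1 / \<delta> ^ n * (LINT \<xi>:?S|\<mu>. f (x + \<delta> * \<xi>) * poly (p n) \<xi>)"
    using eventually_at_right_less[of 0] eventually_at_right_real[OF assms(8)]
    by eventually_elim (use quotient in auto)
  ultimately have lim: "((\<lambda>\<delta>. 1 / \<delta> ^ n *
      (LINT \<xi>:?S|\<mu>. f (x + \<delta> * \<xi>) * poly (p n) \<xi>)) \<longlongrightarrow> L) (at_right 0)"
    by (rule Lim_transform_eventually)
  \<comment> \<open>With \<open>h\<close> and \<open>k\<close> nonzero, the definition of
    \<open>L\<close> can be solved back for the derivative.\<close>
  have "p n \<noteq> 0" "degree (p n) = n"
    using assms(2,3) by (auto simp: orthogonal_polynomials_def)
  then have "h \<noteq> 0"
    using integral_poly_square_nonzero[OF assms(1), of "p n"] assms(3,4) by simp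
  moreover have "k \<noteq> 0"
    using lead_coeff_orthogonal_nonzero[OF assms(2,3)] assms(5) by simp
  ultimately have "nth_deriv_within I f n x = k * fact n / h * L"
    by (simp add: L_def)
  with integrable lim show ?thesis
    by blast
qed

end
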